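(* For every integer $n\ge 9$ such that $\gcd(n,N'(n)/3)=1$, there exists a cyclic constant-weight Gray code for $(1,2,n)$-LRM with weight $w=3$ and size $N=n\cdot N'(n)$, which also has the single-track property.
   Context: The function $N'(n)$ is defined by $$N'(n)=\begin{cases} (n^2-5n+18)/6 & n\equiv 0 \pmod 9\\ (n^2-5n+22)/6 & n\equiv 1 \pmod 9\\ (n^2-5n+24)/6 & n\equiv 2 \pmod 9\\ (n^2-7n+30)/6 & n\equiv 3 \pmod 9\\ (n^2-7n+30)/6 & n\equiv 4 \pmod 9\\ (n^2-7n+28)/6 & n\equiv 5 \pmod 9\\ (n^2-9n+36)/6 & n\equiv 6 \pmod 9\\ (n^2-9n+32)/6 & n\equiv 7 \pmod 9\\ (n^2-9n+26)/6 & n\equiv 8 \pmod 9 \end{cases}$$ ($N'(n)/3$ is an integer.) Write a binary string of length $n$ as $v=v_0v_1\cdots v_{n-1}$ with indices taken modulo $n$. Let $S(n,w)$ be the set of binary strings of length $n$ with exactly $w$ ones (weight $w$). For $0\le j\le n-1$, the string $v'=\tau_j(v)$ is given by $v'_j=0$, $v'_{j+1}=1$ (index mod $n$), and $v'_k=v_k$ for all other $k$. A constant-weight Gray code of weight $w$ and size $N$ for $(1,2,n)$-LRM ("local rank modulation") is a sequence $G=g_0,\dots,g_{N-1}$ of distinct strings in $S(n,w)$ such that for every $0\le i\le N-2$ there is a $j$ with $g_{i+1}=\tau_j(g_i)$. It is cyclic if in addition $g_0=\tau_j(g_{N-1})$ for some $j$. It has the single-track property if, in the $N\times n$ matrix whose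 $i$-th row is $g_i$, all the columns are cyclic shifts of each other. *)

theory Defs
  imports Main
begin

definition Nprime_numerator :: "nat \<Rightarrow> int" where
  "Nprime_numerator n =
     (if n mod 9 = 0 then int n ^ 2 - 5 * int n + 18
      else if n mod 9 = 1 then int n ^ 2 - 5 * int n + 22
      else if n mod 9 = 2 then int n ^ 2 - 5 * int n + 24
      else if n mod 9 = 3 then int n ^ 2 - 7 * int n + 30
      else if n mod 9 = 4 then int n ^ 2 - 7 * int n + 30
      else if n mod 9 = 5 then int n ^ 2 - 7 * int n + 28
      else if n mod 9 = 6 then int n ^ 2 - 9 * int n + 36
      else if n mod 9 = 7 then int n ^ 2 - 9 * int n + 32
      else int n ^ 2 - 9 * int n + 26)"

text \<open>The numerator is positive and divisible by 18 (proved below), so neither \<open>div\<close> nor \<open>nat\<close>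
  loses anything here, nor does \<open>Nprime n div 3\<close>.\<close>

definition Nprime :: "nat \<Rightarrow> nat" where
  "Nprime n = nat (Nprime_numerator n div 6)"

lemma dvd_18_Nprime_numerator: "18 dvd Nprime_numerator n"
proof -
  define q where "q = int (n div 9)"
  define r where "r = n mod 9"
  have n: "int n = 9 * q + int r"
    unfolding q_def r_def by presburger
  have ev: "even (q * q - q)"
    by simp
  then obtain t where t: "q * q = 2 * t + q"
    by (metis add.commute diff_eq_eq evenE)
  have sq: "int n ^ 2 = 162 * t + 81 * q + 18 * (q * int r) + int r * int r"
    using n t by algebra
  have "r < 9"
    by (simp add: r_def)
  then consider "r = 0" | "r = 1" | "r = 2" | "r = 3" | "r = 4" | "r = 5" | "r = 6" | "r = 7" | "r = 8"
    by linarith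
  then show ?thesis
    unfolding Nprime_numerator_def r_def[symmetric] sq
    by cases (simp_all add: n)
qed

lemma Nprime_numerator_pos: "Nprime_numerator n > 0"
proof -
  have "0 \<le> (2 * int n - 5) ^ 2" "0 \<le> (2 * int n - 7) ^ 2" "0 \<le> (2 * int n - 9) ^ 2"
    by simp_all
  then show ?thesis
    unfolding Nprime_numerator_def by (auto simp: power2_eq_square algebra_simps)
qed

lemma six_times_Nprime: "6 * int (Nprime n) = Nprime_numerator n"
proof -
  have "6 dvd Nprime_numerator n"
    by (rule dvd_trans[OF _ dvd_18_Nprime_numerator]) simp
  then show ?thesis
    using Nprime_numerator_pos[of n] by (auto simp: Nprime_def)
qed

lemma three_dvd_Nprime: "3 dvd Nprime n"
  using dvd_18_Nprime_numerator[of n] six_times_Nprime[of n] by presburger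

definition weight_strings :: "nat \<Rightarrow> nat \<Rightarrow> bool list set" where
  "weight_strings n w = {v. length v = n \<and> count_list v True = w}"

definition tau :: "nat \<Rightarrow> bool list \<Rightarrow> bool list" where
  "tau j v = v[j := False, Suc j mod length v := True]"

definition lrm_gray_code :: "nat \<Rightarrow> nat \<Rightarrow> nat \<Rightarrow> bool list list \<Rightarrow> bool" where
  "lrm_gray_code n w N G \<longleftrightarrow>
     length G = N \<and> distinct G \<and> set G \<subseteq> weight_strings n w \<and>
     (\<forall>i. Suc i < N \<longrightarrow> (\<exists>j<n. G ! Suc i = tau j (G ! i)))"

definition cyclic_lrm_gray_code :: "nat \<Rightarrow> nat \<Rightarrow> nat \<Rightarrow> bool list list \<Rightarrow> bool" where
  "cyclic_lrm_gray_code n w N G \<longleftrightarrow>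
     lrm_gray_code n w N G \<and> (\<exists>j<n. G ! 0 = tau j (G ! (N - 1)))"

definition column :: "bool list list \<Rightarrow> nat \<Rightarrow> bool list" where
  "column G k = map (\<lambda>g. g ! k) G"

definition single_track :: "nat \<Rightarrow> bool list list \<Rightarrow> bool" where
  "single_track n G \<longleftrightarrow> (\<forall>k<n. \<forall>l<n. \<exists>s. column G l = rotate s (column G k))"

end

(* Up to rotation of the ring, a word of weight 3 is a triple of gaps (a, b, c) between consecutive
   ones, up to cyclic permutation, and every move lengthens one gap by one at the expense of the next.
   A simple cycle of 3 s gap triples that returns without permuting the gaps uses each of the three
   moves s times, so following it once rotates the word by s; if s is coprime to n, following it
   n times gives a cyclic Gray code, and a shift in time by 3 s moves each column to the column
   s places further on, hence the single track.

   With k = n div 3, the triples with b <= k < c form a fundamental domain for the permutation of the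
   gaps. In the coordinates i = c - k - 1 and j = b - 1 it is a trapezoid of k rows in the lattice,
   with moves (1, 0), (0, -1) and (-1, 1). The cycle runs through strips of three rows: right along
   the lowest row, then back in a zigzag along the other two, stopping short of the left end to climb
   into the next strip; after the last strip it descends along the left edge. *)

theory Submission
  imports Defs "HOL-Number_Theory.Cong"
begin

section \<open>Words with three particles on a ring\<close>

text \<open>Positions are unreduced naturals, so particles can move forward indefinitely and gaps
  are plain differences.\<close>

definition ring_word :: "nat \<Rightarrow> nat \<Rightarrow> nat \<Rightarrow> nat \<Rightarrow> bool list" where
  "ring_word n p q r = map (\<lambda>i. i \<in> {p mod n, q mod n, r mod n}) [0..<n]"

lemma length_ring_word [simp]: "length (ring_word n p q r) = n"
  by (simp add: ring_word_def)

lemma nth_ring_word: "i < n \<Longrightarrow> ring_word n p q r ! i \<longleftrightarrow> i \<in> {p mod n, q mod n, r mod n}"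
  by (simp add: ring_word_def)

lemma ring_word_rotate: "ring_word n p q r = ring_word n q r p"
  by (auto simp: ring_word_def)

lemma ring_word_add_mult:
  "ring_word n (p + n * m) (q + n * m) (r + n * m) = ring_word n p q r"
  by (simp add: ring_word_def)

lemma add_mod_inj:
  fixes x y s n :: nat
  assumes "(x + s) mod n = (y + s) mod n"
  shows "x mod n = y mod n"
  using assms by (metis cong_add_rcancel_nat cong_def)

lemma nth_ring_word_add:
  assumes "i < n"
  shows "ring_word n (p + s) (q + s) (r + s) ! ((i + s) mod n) = ring_word n p q r ! i"
proof -
  have "(i + s) mod n = (x + s) mod n \<longleftrightarrow> i = x mod n" for x
    using assms add_mod_inj[of i s n x] by (metis mod_add_left_eq mod_less)
  moreover have "(i + s) mod n < n"
    using assms by simp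
  ultimately show ?thesis
    using assms by (simp add: nth_ring_word)
qed

lemma add_mod_neq:
  fixes x d n :: nat
  assumes "0 < d" "d < n"
  shows "x mod n \<noteq> (x + d) mod n"
proof
  assume "x mod n = (x + d) mod n"
  then have "(0 + x) mod n = (d + x) mod n"
    by (simp add: add.commute)
  from add_mod_inj[OF this] show False
    using assms by simp
qed

lemma ring_word_in_weight_strings:
  assumes "0 < a" "0 < b" "a + b < n"
  shows "ring_word n x (x + a) (x + a + b) \<in> weight_strings n 3"
proof -
  have "x mod n \<noteq> (x + a) mod n" "x mod n \<noteq> (x + a + b) mod n"
    "(x + a) mod n \<noteq> (x + a + b) mod n"
    using assms add_mod_neq[of a n x] add_mod_neq[of "a + b" n x] add_mod_neq[of b n "x + a"]
    by (simp_all add: add.assoc)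
  then have "card {x mod n, (x + a) mod n, (x + a + b) mod n} = 3"
    by simp
  moreover have "{i. i < n \<and> ring_word n x (x + a) (x + a + b) ! i}
      = {x mod n, (x + a) mod n, (x + a + b) mod n}"
    using assms by (auto simp: nth_ring_word)
  ultimately show ?thesis
    by (simp add: weight_strings_def count_list_eq_length_filter length_filter_conv_card)
qed

text \<open>Neither \<open>q\<close> nor \<open>r\<close> may lie at \<open>p\<close>, or clearing
  that bit would erase it as well. With \<open>ring_word_rotate\<close> this covers a move of any of
  the three particles.\<close>

lemma tau_ring_word:
  assumes "2 \<le> n" "p mod n \<noteq> q mod n" "p mod n \<noteq> r mod n"
  shows "tau (p mod n) (ring_word n p q r) = ring_word n (Suc p) q r"
proof (rule nth_equalityI)
  fix i
  assume "i < length (tau (p mod n) (ring_word n p q r))"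
  then have i: "i < n"
    by (simp add: tau_def)
  have "p mod n \<noteq> Suc p mod n"
    using add_mod_neq[of 1 n p] assms(1) by simp
  then show "tau (p mod n) (ring_word n p q r) ! i = ring_word n (Suc p) q r ! i"
    using assms i by (auto simp: tau_def nth_ring_word nth_list_update mod_Suc_eq)
qed (simp add: tau_def)

lemma ring_word_cong_mod:
  assumes "x mod n = y mod n"
  shows "ring_word n x (x + a) (x + b) = ring_word n y (y + a) (y + b)"
  using assms mod_add_cong[of x n y a a] mod_add_cong[of x n y b b] by (simp add: ring_word_def)

text \<open>Read from the common first particle on, the ones stand at offsets \<open>0\<close>,
  \<open>a\<close>, \<open>a + b\<close>, and this set together with its order gives the
  gaps.\<close>

lemma ring_word_gaps_inj:
  assumes eq: "ring_word n x (x + a) (x + a + b) = ring_word n y (y + a') (y + a' + b')"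
    and "x mod n = y mod n"
    and ab: "0 < a" "0 < b" "a + b < n"
    and ab': "0 < a'" "0 < b'" "a' + b' < n"
  shows "a = a' \<and> b = b'"
proof -
  have word: "ring_word n x (x + a) (x + a + b) ! ((i + x) mod n) \<longleftrightarrow> i \<in> {0, a, a + b}"
    if "0 < a" "0 < b" "a + b < n" "i < n" for a b i
    using nth_ring_word_add[of i n 0 x a "a + b"] that
    by (simp add: nth_ring_word add_ac)
  have eq': "ring_word n x (x + a) (x + a + b) = ring_word n x (x + a') (x + a' + b')"
    using eq ring_word_cong_mod[OF assms(2), of a' "a' + b'"] by (simp add: add.assoc)
  have "i \<in> {0, a, a + b} \<longleftrightarrow> i \<in> {0, a', a' + b'}" if "i < n" for i
    using word[OF ab that] word[OF ab' that] eq' by simp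
  from this[of a] this[of "a + b"] this[of a']
  have "a = a' \<or> a = a' + b'" "a + b = a' \<or> a + b = a' + b'" "a' = a \<or> a' = a + b"
    using ab ab' by simp_all
  then show ?thesis
    using ab ab' by linarith
qed

text \<open>The bounds \<open>b \<le> k < n - a - b\<close> on two consecutive gaps cut out a fundamental domain for the
  rotation of the three gaps, so the word determines which particle comes first.\<close>

lemma ring_word_inj:
  fixes x a b x' a' b' n k :: nat
  assumes eq: "ring_word n x (x + a) (x + a + b) = ring_word n x' (x' + a') (x' + a' + b')"
    and ab: "0 < a" "0 < b" "b \<le> k" "a + b + k < n"
    and ab': "0 < a'" "0 < b'" "b' \<le> k" "a' + b' + k < n"
  shows "x mod n = x' mod n \<and> a = a' \<and> b = b'"
proof -
  have n: "a + b < n" "a' + b' < n" "0 < n"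
    using ab ab' by simp_all
  define c where "c = n - (a + b)"
  have c: "a + b + c = n" "k < c"
    using ab by (simp_all add: c_def)
  have "x' mod n < n"
    using n by simp
  \<comment> \<open>The first description must have a particle at \<open>x'\<close>. If it is the
    second or third one, the gaps read from there are \<open>(b, c, a)\<close> or
    \<open>(c, a, b)\<close>: then \<open>c = b'\<close> contradicts \<open>b' <= k < c\<close>, or
    \<open>b\<close> is the third gap, which exceeds \<open>k\<close>.\<close>
  then have "x' mod n \<in> {x mod n, (x + a) mod n, (x + a + b) mod n}"
    using arg_cong[OF eq, of "\<lambda>v. v ! (x' mod n)"] by (simp add: nth_ring_word)
  then consider "x mod n = x' mod n" | "(x + a) mod n = x' mod n" | "(x + a + b) mod n = x' mod n"
    by auto
  then show ?thesis
  proof cases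
    case 1
    then show ?thesis
      using ring_word_gaps_inj[OF eq] ab ab' n by blast
  next
    case 2
    have "ring_word n (x + a) (x + a + b) (x + a + b + c) = ring_word n (x + a) (x + a + b) x"
      using c by (simp add: ring_word_def add.assoc)
    then have "ring_word n (x + a) (x + a + b) (x + a + b + c) = ring_word n x' (x' + a') (x' + a' + b')"
      using eq ring_word_rotate by metis
    from ring_word_gaps_inj[OF this 2] have "c = b'"
      using ab ab' n c by simp
    then show ?thesis
      using ab' c by simp
  next
    case 3
    have "ring_word n (x + a + b) (x + a + b + c) (x + a + b + c + a) = ring_word n (x + a + b) (x + n) (x + a + n)"
      using c by (intro arg_cong3[where f = "ring_word n"]) linarith+
    also have "\<dots> = ring_word n (x + a + b) x (x + a)"
      by (simp add: ring_word_def)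
    finally have "ring_word n (x + a + b) (x + a + b + c) (x + a + b + c + a)
        = ring_word n x' (x' + a') (x' + a' + b')"
      using eq ring_word_rotate by metis
    from ring_word_gaps_inj[OF this 3] have "c = a'" "a = b'"
      using ab ab' n c by simp_all
    then show ?thesis
      using ab ab' c by linarith
  qed
qed

section \<open>From a cycle of gaps to a Gray code\<close>

text \<open>\<open>A\<close> and \<open>B\<close> are the first two gaps as functions of time; the
  third is \<open>n - A t - B t\<close>. The alternatives of \<open>gaps_step\<close> are moves of
  the first, second and third particle.\<close>

locale gap_cycle =
  fixes n k s :: nat and A B :: "nat \<Rightarrow> nat"
  assumes A_pos: "0 < A t" and B_pos: "0 < B t" and B_le: "B t \<le> k" and A_B_less: "A t + B t + k < n"
    and A_periodic: "A (t + 3 * s) = A t" and B_periodic: "B (t + 3 * s) = B t"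
    and gaps_inj: "A t = A u \<Longrightarrow> B t = B u \<Longrightarrow> t mod (3 * s) = u mod (3 * s)"
    and gaps_step: "A t = Suc (A (Suc t)) \<and> B (Suc t) = B t
      \<or> A (Suc t) = Suc (A t) \<and> B t = Suc (B (Suc t))
      \<or> A (Suc t) = A t \<and> B (Suc t) = Suc (B t)"
    and coprime: "coprime n s"
begin

text \<open>The unreduced position of the first particle, which moves exactly when \<open>A\<close>
  drops.\<close>

primrec base :: "nat \<Rightarrow> nat" where
  "base 0 = 0"
| "base (Suc t) = (if A (Suc t) < A t then Suc (base t) else base t)"

text \<open>Three times the base plus twice the first gap plus the second gap is the sum of the three
  positions, which grows by one with every move.\<close>

lemma base_invariant: "3 * base t + 2 * A t + B t = t + 2 * A 0 + B 0"
proof (induction t)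
  case (Suc t)
  then show ?case
    using gaps_step[of t] by auto
qed simp

lemma gaps_periodic_mult: "A (t + r * (3 * s)) = A t \<and> B (t + r * (3 * s)) = B t"
proof (induction r)
  case (Suc r)
  have "t + Suc r * (3 * s) = (t + r * (3 * s)) + 3 * s"
    by simp
  then show ?case
    using Suc A_periodic B_periodic by metis
qed simp

text \<open>The gaps agree at both times and cancel in \<open>base_invariant\<close>, so three times
  the base absorbs all \<open>r * (3 * s)\<close> moves.\<close>

lemma base_add_period: "base (t + r * (3 * s)) = base t + r * s"
  using base_invariant[of t] base_invariant[of "t + r * (3 * s)"] gaps_periodic_mult[of t r]
  by (simp add: algebra_simps)

definition state :: "nat \<Rightarrow> bool list" where
  "state t = ring_word n (base t) (base t + A t) (base t + A t + B t)"

lemma n_ge_2: "2 \<le> n"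
  using A_pos[of 0] B_pos[of 0] A_B_less[of 0] by linarith

lemma s_pos: "0 < s"
  using coprime n_ge_2 by (cases s) auto

lemma state_in_weight_strings: "state t \<in> weight_strings n 3"
  unfolding state_def using A_pos B_pos A_B_less by (intro ring_word_in_weight_strings) (auto intro: add_lessD1)

lemma state_Suc: "\<exists>j<n. state (Suc t) = tau j (state t)"
proof -
  define x a b where xab: "x = base t" "a = A t" "b = B t"
  have pos: "0 < a" "0 < b" "a + b < n"
    using A_pos[of t] B_pos[of t] A_B_less[of t] by (auto simp: xab)
  have neq: "x mod n \<noteq> (x + a) mod n" "x mod n \<noteq> (x + a + b) mod n"
    "(x + a) mod n \<noteq> (x + a + b) mod n"
    using pos add_mod_neq[of a n x] add_mod_neq[of "a + b" n x] add_mod_neq[of b n "x + a"]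
    by (simp_all add: add.assoc)
  have state: "state t = ring_word n x (x + a) (x + a + b)"
    by (simp add: state_def xab)
  consider (R) "A t = Suc (A (Suc t))" "B (Suc t) = B t"
    | (D) "A (Suc t) = Suc (A t)" "B t = Suc (B (Suc t))"
    | (U) "A (Suc t) = A t" "B (Suc t) = Suc (B t)"
    using gaps_step[of t] by blast
  then have "\<exists>p. state (Suc t) = tau (p mod n) (state t)"
  proof cases
    case R
    then have "state (Suc t) = ring_word n (Suc x) (x + a) (x + a + b)"
      by (simp add: state_def xab)
    then show ?thesis
      using tau_ring_word[OF n_ge_2, of x "x + a" "x + a + b"] neq state by metis
  next
    case D
    then have "state (Suc t) = ring_word n (Suc (x + a)) (x + a + b) x"
      by (simp add: state_def xab ring_word_rotate[of _ "base t"])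
    then show ?thesis
      using tau_ring_word[OF n_ge_2, of "x + a" "x + a + b" x] neq state ring_word_rotate by metis
  next
    case U
    then have "state (Suc t) = ring_word n (Suc (x + a + b)) x (x + a)"
      by (simp add: state_def xab ring_word_rotate[of _ "Suc _"])
    then show ?thesis
      using tau_ring_word[OF n_ge_2, of "x + a + b" x "x + a"] neq state ring_word_rotate by metis
  qed
  moreover have "p mod n < n" for p
    using n_ge_2 by simp
  ultimately show ?thesis
    by blast
qed

lemma state_add_period:
  "state (t + r * (3 * s)) = ring_word n (base t + r * s) (base t + A t + r * s) (base t + A t + B t + r * s)"
  using gaps_periodic_mult[of t r] by (simp add: state_def base_add_period add_ac)

lemma nth_state_add_period:
  "i < n \<Longrightarrow> state (t + r * (3 * s)) ! ((i + r * s) mod n) = state t ! i"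
  unfolding state_add_period by (simp only: nth_ring_word_add state_def)

lemma state_periodic: "state (t + n * (3 * s)) = state t"
  unfolding state_add_period by (simp only: ring_word_add_mult state_def mult.commute)

lemma state_mod: "state (t mod (n * (3 * s))) = state t"
proof -
  have "state (u + r * (n * (3 * s))) = state u" for u r
  proof (induction r)
    case (Suc r)
    then show ?case
      using state_periodic[of "u + r * (n * (3 * s))"] by (simp add: add_ac)
  qed simp
  then show ?thesis
    by (metis mod_div_mult_eq)
qed

text \<open>Equal words have equal gaps, so the times differ by \<open>r\<close> periods; these turn
  the word by \<open>r * s\<close>, which \<open>n\<close> must divide. Coprimality and
  \<open>r < n\<close> leave only \<open>r = 0\<close>.\<close>

lemma state_inj_aux:
  assumes "state t = state u" "t \<le> u" "u < n * (3 * s)"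
  shows "t = u"
proof -
  have *: "base t mod n = base u mod n \<and> A t = A u \<and> B t = B u"
    using assms(1) A_pos B_pos B_le A_B_less unfolding state_def by (intro ring_word_inj[where k = k]) auto
  then have "t mod (3 * s) = u mod (3 * s)"
    using gaps_inj by blast
  then obtain r where u: "u = t + r * (3 * s)"
    using assms(2) by (metis mod_eq_nat1E mult.commute)
  have "(0 + base t) mod n = (r * s + base t) mod n"
    using * by (simp add: u base_add_period add.commute)
  from add_mod_inj[OF this] have "n dvd r * s"
    by (simp add: mod_eq_0_iff_dvd)
  then have "n dvd r"
    using coprime by (simp add: coprime_dvd_mult_left_iff)
  moreover have "r < n"
  proof -
    have "r * (3 * s) < n * (3 * s)"
      using assms(3) unfolding u by linarith
    then show ?thesis
      by simp
  qed
  ultimately show ?thesis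
    using u by (auto dest: dvd_imp_le)
qed

lemma state_inj: "inj_on state {..<n * (3 * s)}"
  using state_inj_aux by (intro inj_onI) (metis lessThan_iff nat_le_linear)

definition code :: "bool list list" where
  "code = map state [0..<n * (3 * s)]"

lemma length_code: "length code = n * (3 * s)"
  by (simp add: code_def)

lemma nth_code: "t < n * (3 * s) \<Longrightarrow> code ! t = state t"
  by (simp add: code_def)

lemma cyclic_lrm_gray_code_code: "cyclic_lrm_gray_code n 3 (n * (3 * s)) code"
proof -
  have pos: "0 < n * (3 * s)"
    using n_ge_2 s_pos by simp
  \<comment> \<open>The time after the last one completes \<open>n\<close> periods, and there the
    word is back at its start.\<close>
  have "code ! 0 = state (Suc (n * (3 * s) - 1))"
    using pos state_periodic[of 0] by (simp add: nth_code)
  then have "\<exists>j<n. code ! 0 = tau j (code ! (n * (3 * s) - 1))"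
    using state_Suc[of "n * (3 * s) - 1"] pos by (simp add: nth_code)
  moreover have "distinct code"
    using state_inj by (simp add: code_def distinct_map atLeast0LessThan)
  ultimately show ?thesis
    using state_Suc state_in_weight_strings
    by (auto simp: cyclic_lrm_gray_code_def lrm_gray_code_def length_code nth_code)
       (auto simp: code_def)
qed

lemma single_track_code: "single_track n code"
  unfolding single_track_def
proof (intro allI impI)
  fix i l
  assume il: "i < n" "l < n"
  obtain v where v: "[s * v = 1] (mod n)"
    using cong_solve_coprime_nat[of s n] coprime by (auto simp: coprime_commute)
  \<comment> \<open>\<open>r\<close> solves \<open>l + r * s = i\<close> modulo \<open>n\<close>, so
    \<open>r\<close> periods later column \<open>i\<close> shows what column \<open>l\<close> shows
    now. The summand \<open>n\<close> keeps the subtraction exact.\<close>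
  define r where "r = (i + n - l) * v"
  have "[l + (i + n - l) * (s * v) = l + (i + n - l) * 1] (mod n)"
    using v by (intro cong_add cong_mult) auto
  then have i: "(l + r * s) mod n = i"
    using il by (simp add: r_def cong_def mult_ac)
  have "column code l ! t = rotate (r * (3 * s)) (column code i) ! t" if t: "t < n * (3 * s)" for t
  proof -
    have "rotate (r * (3 * s)) (column code i) ! t = state (t + r * (3 * s)) ! i"
      using t n_ge_2 s_pos by (simp add: nth_rotate column_def length_code nth_code state_mod add.commute)
    also have "\<dots> = state t ! l"
      using nth_state_add_period[OF il(2), of t r] i by simp
    also have "\<dots> = column code l ! t"
      using t by (simp add: column_def length_code nth_code)
    finally show ?thesis ..
  qed
  then have "column code l = rotate (r * (3 * s)) (column code i)"
    by (intro nth_equalityI) (simp_all add: column_def length_code)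
  then show "\<exists>m. column code l = rotate m (column code i)" ..
qed

end

section \<open>Lattice coordinates for the gaps\<close>

text \<open>Right, down and up-left, in the order of the alternatives of \<open>gaps_step\<close>.
  \<open>Suc\<close> on the larger side rules out steps below zero.\<close>

definition lattice_step :: "nat \<times> nat \<Rightarrow> nat \<times> nat \<Rightarrow> bool" where
  "lattice_step u v \<longleftrightarrow>
     fst v = Suc (fst u) \<and> snd v = snd u \<or>
     fst v = fst u \<and> snd u = Suc (snd v) \<or>
     fst u = Suc (fst v) \<and> snd v = Suc (snd u)"

text \<open>At the point \<open>(i, j)\<close> the gaps are \<open>b = j + 1\<close> and
  \<open>c = i + k + 1\<close>, which leaves \<open>a = w - i - j\<close> with
  \<open>w = n - k - 2\<close>. Thus \<open>w\<close> is the width of the bottom row.\<close>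

lemma gap_cycle_of_lattice_cycle:
  fixes n k w s :: nat and P :: "(nat \<times> nat) list"
  assumes len: "length P = 3 * s"
    and dist: "distinct P"
    and succ: "successively lattice_step P" and close: "lattice_step (last P) (hd P)"
    and bounds: "\<And>u. u \<in> set P \<Longrightarrow> fst u + snd u < w \<and> snd u < k"
    and w: "w + k + 2 = n"
    and coprime: "coprime n s"
  shows "gap_cycle n k s (\<lambda>t. w - fst (P ! (t mod (3 * s))) - snd (P ! (t mod (3 * s))))
           (\<lambda>t. Suc (snd (P ! (t mod (3 * s)))))"
proof -
  define p where "p t = P ! (t mod (3 * s))" for t
  have s: "0 < s"
    using coprime w by (cases s) auto
  then have "P \<noteq> []"
    using len by auto
  have less: "t mod (3 * s) < length P" for t
    using s len by simp
  have p: "fst (p t) + snd (p t) < w" "snd (p t) < k" for t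
    using bounds[OF nth_mem[OF less[of t]]] by (simp_all add: p_def)
  have step: "lattice_step (p t) (p (Suc t))" for t
  proof (cases "Suc (t mod (3 * s)) = 3 * s")
    case True
    then have "t mod (3 * s) = 3 * s - 1"
      by simp
    then have "p t = last P" "p (Suc t) = hd P"
      using \<open>P \<noteq> []\<close> len s by (simp_all add: p_def mod_Suc last_conv_nth hd_conv_nth)
    then show ?thesis
      using close by simp
  next
    case False
    then have "p (Suc t) = P ! Suc (t mod (3 * s))" "Suc (t mod (3 * s)) < length P"
      using less[of t] len by (auto simp: p_def mod_Suc)
    then show ?thesis
      using succ by (simp add: p_def successively_conv_nth)
  qed
  show ?thesis
    unfolding p_def[symmetric]
  proof
    fix t u
    show "0 < w - fst (p t) - snd (p t)" "0 < Suc (snd (p t))" "Suc (snd (p t)) \<le> k"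
      using p[of t] by auto
    show "w - fst (p t) - snd (p t) + Suc (snd (p t)) + k < n"
      using p[of t] w by linarith
    show "w - fst (p (t + 3 * s)) - snd (p (t + 3 * s)) = w - fst (p t) - snd (p t)"
      "Suc (snd (p (t + 3 * s))) = Suc (snd (p t))"
      by (simp_all add: p_def)
    show "t mod (3 * s) = u mod (3 * s)"
      if "w - fst (p t) - snd (p t) = w - fst (p u) - snd (p u)" "Suc (snd (p t)) = Suc (snd (p u))"
    proof -
      \<comment> \<open>Inside the trapezoid the truncated differences are exact, so the gaps
        determine both coordinates.\<close>
      have "p t = p u"
        using that p[of t] p[of u] by (intro prod_eqI) linarith+
      then show ?thesis
        using dist less by (simp add: p_def nth_eq_iff_index_eq)
    qed
    show "w - fst (p t) - snd (p t) = Suc (w - fst (p (Suc t)) - snd (p (Suc t))) \<and> Suc (snd (p (Suc t))) = Suc (snd (p t))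
      \<or> w - fst (p (Suc t)) - snd (p (Suc t)) = Suc (w - fst (p t) - snd (p t)) \<and> Suc (snd (p t)) = Suc (Suc (snd (p (Suc t))))
      \<or> w - fst (p (Suc t)) - snd (p (Suc t)) = w - fst (p t) - snd (p t) \<and> Suc (snd (p (Suc t))) = Suc (Suc (snd (p t)))"
      using step[of t] p[of t] p[of "Suc t"] unfolding lattice_step_def by linarith
  qed (use coprime in simp)
qed

section \<open>Strips and the closed snake\<close>

text \<open>Up-left and down steps alternate from \<open>(m, h + 1)\<close> to
  \<open>(2, h + 2)\<close>, from where one more up-left step enters the next strip.\<close>

definition zigzag :: "nat \<Rightarrow> nat \<Rightarrow> (nat \<times> nat) list" where
  "zigzag h m = concat (map (\<lambda>i. [(Suc i, Suc h), (i, Suc (Suc h))]) (rev [2..<m]))"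

text \<open>Column 0 is left out for the final descent. The zigzag starts up-left of the end of the
  bottom row, hence the \<open>- 2\<close>.\<close>

definition strip :: "nat \<Rightarrow> nat \<Rightarrow> (nat \<times> nat) list" where
  "strip w t = map (\<lambda>i. (i, 3 * t)) [1..<w - 3 * t] @ zigzag (3 * t) (w - 3 * t - 2)"

text \<open>The end of the zigzag in the last strip, whose lowest row is \<open>h\<close>, and the descent along the left edge.\<close>

definition tail :: "nat \<Rightarrow> (nat \<times> nat) list" where
  "tail h = [(2, Suc h), (1, h + 2), (1, Suc h)] @ map (Pair 0) (rev [0..<h + 3])"

lemma zigzag_Suc: "2 \<le> m \<Longrightarrow> zigzag h (Suc m) = (Suc m, Suc h) # (m, Suc (Suc h)) # zigzag h m"
  by (simp add: zigzag_def)

lemma zigzag_2: "zigzag h 2 = []"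
  by (simp add: zigzag_def)

lemma zigzag_props:
  assumes "3 \<le> m"
  shows "length (zigzag h m) = 2 * (m - 2) \<and> zigzag h m \<noteq> [] \<and> hd (zigzag h m) = (m, Suc h)
    \<and> last (zigzag h m) = (2, Suc (Suc h)) \<and> successively lattice_step (zigzag h m)
    \<and> distinct (zigzag h m)
    \<and> set (zigzag h m) \<subseteq> {(i, j). 3 \<le> i \<and> i \<le> m \<and> j = Suc h \<or> 2 \<le> i \<and> i < m \<and> j = Suc (Suc h)}"
  using assms
proof (induction m rule: dec_induct)
  case base
  have "zigzag h 3 = [(3, Suc h), (2, Suc (Suc h))]"
    using zigzag_Suc[of 2 h] by (simp add: zigzag_2)
  then show ?case
    by (simp add: lattice_step_def)
next
  case (step m)
  then have "zigzag h (Suc m) = (Suc m, Suc h) # (m, Suc (Suc h)) # zigzag h m"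
    by (intro zigzag_Suc) simp
  with step show ?case
    by (auto simp: successively_Cons lattice_step_def)
qed

text \<open>Width at least 5 makes the zigzag nonempty. With \<open>d = w - 3 * t\<close> the length
  is \<open>(d - 1) + 2 * (d - 4) = 3 * d - 9\<close>.\<close>

lemma strip_props:
  assumes "5 \<le> w - 3 * t"
  shows "length (strip w t) + 9 * Suc t = 3 * w \<and> strip w t \<noteq> [] \<and> hd (strip w t) = (1, 3 * t)
    \<and> last (strip w t) = (2, 3 * t + 2) \<and> successively lattice_step (strip w t)
    \<and> distinct (strip w t)
    \<and> set (strip w t) \<subseteq> {(i, j). i + j < w \<and> (1 \<le> i \<and> j = 3 * t \<or> 3 \<le> i \<and> j = 3 * t + 1 \<or> 2 \<le> i \<and> j = 3 * t + 2)}"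
proof -
  define d where "d = w - 3 * t"
  have d: "5 \<le> d" "w = d + 3 * t"
    using assms by (simp_all add: d_def)
  have z: "length (zigzag (3 * t) (d - 2)) = 2 * (d - 4)" "zigzag (3 * t) (d - 2) \<noteq> []"
    "hd (zigzag (3 * t) (d - 2)) = (d - 2, Suc (3 * t))"
    "last (zigzag (3 * t) (d - 2)) = (2, Suc (Suc (3 * t)))"
    "successively lattice_step (zigzag (3 * t) (d - 2))"
    "distinct (zigzag (3 * t) (d - 2))"
    "set (zigzag (3 * t) (d - 2)) \<subseteq> {(i, j). 3 \<le> i \<and> i \<le> d - 2 \<and> j = Suc (3 * t)
      \<or> 2 \<le> i \<and> i < d - 2 \<and> j = Suc (Suc (3 * t))}"
    using zigzag_props[of "d - 2" "3 * t"] d by auto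
  have "successively lattice_step (map (\<lambda>i. (i, 3 * t)) [1..<d])"
    by (simp add: successively_conv_nth lattice_step_def)
  moreover have "last (map (\<lambda>i. (i, 3 * t)) [1..<d]) = (d - 1, 3 * t)"
    using d by (simp add: last_map)
  ultimately have "successively lattice_step (strip w t)"
    using d z by (auto simp: strip_def d_def[symmetric] successively_append_iff lattice_step_def)
  moreover have "distinct (strip w t)"
    using z by (auto simp: strip_def d_def[symmetric] distinct_map inj_on_def)
  moreover have "set (strip w t) \<subseteq> {(i, j). i + j < w \<and> (1 \<le> i \<and> j = 3 * t \<or> 3 \<le> i \<and> j = 3 * t + 1 \<or> 2 \<le> i \<and> j = 3 * t + 2)}"
    using z(7) d by (fastforce simp: strip_def d_def[symmetric])
  ultimately show ?thesis
    using d z by (auto simp: strip_def d_def[symmetric] hd_map)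
qed

definition strips :: "nat \<Rightarrow> nat \<Rightarrow> (nat \<times> nat) list" where
  "strips w q = concat (map (strip w) [0..<q])"

lemma strips_Suc: "strips w (Suc q) = strips w q @ strip w q"
  by (simp add: strips_def)

text \<open>The length is doubled because the deficits \<open>9 * Suc t\<close> sum to a triangular
  number. The lower bounds on \<open>i\<close> keep the points of \<open>tail (3 * q)\<close>
  free.\<close>

lemma strips_props:
  assumes "3 * q + 5 \<le> w"
  shows "2 * length (strips w (Suc q)) + 9 * (q + 1) * (q + 2) = 6 * Suc q * w
    \<and> strips w (Suc q) \<noteq> [] \<and> hd (strips w (Suc q)) = (1, 0)
    \<and> last (strips w (Suc q)) = (2, 3 * q + 2) \<and> successively lattice_step (strips w (Suc q))
    \<and> distinct (strips w (Suc q))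
    \<and> (\<forall>(i, j) \<in> set (strips w (Suc q)). i + j < w \<and> 1 \<le> i \<and> j < 3 * q + 3
        \<and> (j = 3 * q + 1 \<longrightarrow> 3 \<le> i) \<and> (j = 3 * q + 2 \<longrightarrow> 2 \<le> i))"
  using assms
proof (induction q)
  case 0
  have "strips w (Suc 0) = strip w 0"
    by (simp add: strips_def)
  with strip_props[of w 0] 0 show ?case
    by auto
next
  case (Suc q)
  have IH: "2 * length (strips w (Suc q)) + 9 * (q + 1) * (q + 2) = 6 * Suc q * w"
    "strips w (Suc q) \<noteq> []" "hd (strips w (Suc q)) = (1, 0)"
    "last (strips w (Suc q)) = (2, 3 * q + 2)" "successively lattice_step (strips w (Suc q))"
    "distinct (strips w (Suc q))"
    "\<forall>(i, j) \<in> set (strips w (Suc q)). i + j < w \<and> 1 \<le> i \<and> j < 3 * q + 3"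
    using Suc by auto
  have "5 \<le> w - 3 * Suc q"
    using Suc.prems by simp
  note S = strip_props[OF this]
  have "2 * length (strips w (Suc (Suc q))) + 9 * (Suc q + 1) * (Suc q + 2) = 6 * Suc (Suc q) * w"
    using IH(1) S by (simp add: strips_Suc[of _ "Suc q"] algebra_simps)
  \<comment> \<open>An up-left step joins consecutive strips.\<close>
  moreover have "lattice_step (2, 3 * q + 2) (1, 3 * Suc q)"
    by (simp add: lattice_step_def)
  then have "successively lattice_step (strips w (Suc (Suc q)))"
    using IH S by (simp add: strips_Suc[of _ "Suc q"] successively_append_iff)
  moreover have "distinct (strips w (Suc (Suc q)))"
    using IH(6,7) S by (fastforce simp: strips_Suc[of _ "Suc q"])
  moreover have "\<forall>(i, j) \<in> set (strips w (Suc (Suc q))). i + j < w \<and> 1 \<le> i \<and> j < 3 * Suc q + 3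
        \<and> (j = 3 * Suc q + 1 \<longrightarrow> 3 \<le> i) \<and> (j = 3 * Suc q + 2 \<longrightarrow> 2 \<le> i)"
    using IH(7) S by (fastforce simp: strips_Suc[of _ "Suc q"])
  ultimately show ?case
    using IH S by (simp add: strips_Suc[of _ "Suc q"])
qed

text \<open>Note the offset: there are \<open>q + 1\<close> strips.\<close>

definition snake :: "nat \<Rightarrow> nat \<Rightarrow> (nat \<times> nat) list" where
  "snake w q = strips w (Suc q) @ tail (3 * q)"

lemma tail_props:
  "length (tail h) = h + 6 \<and> hd (tail h) = (2, Suc h) \<and> last (tail h) = (0, 0)
    \<and> successively lattice_step (tail h) \<and> distinct (tail h)"
proof -
  have "successively lattice_step (map (Pair 0) (rev [0..<h + 3]))"
    unfolding successively_map successively_rev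
    by (simp add: successively_conv_nth lattice_step_def del: upt_Suc)
  then show ?thesis
    by (auto simp: tail_def inj_on_def successively_Cons lattice_step_def distinct_map hd_map last_map hd_rev last_rev
        simp del: upt_Suc)
qed

lemma snake_props_wide:
  assumes "3 * q + 5 \<le> w"
  shows "2 * length (snake w q) + 9 * (q + 1) * (q + 2) = 6 * (q + 1) * w + 6 * (q + 2)"
    and "distinct (snake w q)"
    and "successively lattice_step (snake w q)"
    and "lattice_step (last (snake w q)) (hd (snake w q))"
    and "u \<in> set (snake w q) \<Longrightarrow> fst u + snd u < w \<and> snd u < 3 * (q + 1)"
proof -
  note S = strips_props[OF assms] and T = tail_props[of "3 * q"]
  have "tail (3 * q) \<noteq> []"
    by (simp add: tail_def)
  show "2 * length (snake w q) + 9 * (q + 1) * (q + 2) = 6 * (q + 1) * w + 6 * (q + 2)"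
    using S T by (simp add: snake_def)
  \<comment> \<open>The joint is the down step from \<open>(2, 3 * q + 2)\<close> to
    \<open>(2, 3 * q + 1)\<close>; the cycle then closes with the right step from
    \<open>(0, 0)\<close> to \<open>(1, 0)\<close>.\<close>
  show "successively lattice_step (snake w q)"
    using S T by (simp add: snake_def successively_append_iff lattice_step_def)
  show "lattice_step (last (snake w q)) (hd (snake w q))"
    using S T \<open>tail (3 * q) \<noteq> []\<close> by (simp add: snake_def lattice_step_def)
  have tail: "set (tail (3 * q)) =
      {(2, 3 * q + 1), (1, 3 * q + 2), (1, 3 * q + 1)} \<union> Pair 0 ` {0..<3 * q + 3}"
    by (simp add: tail_def del: upt_Suc)
  then have "set (strips w (Suc q)) \<inter> set (tail (3 * q)) = {}"
    using S by fastforce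
  then show "distinct (snake w q)"
    using S T by (simp add: snake_def)
  show "fst u + snd u < w \<and> snd u < 3 * (q + 1)" if "u \<in> set (snake w q)"
  proof (cases "u \<in> set (tail (3 * q))")
    case True
    then show ?thesis
      using assms unfolding tail by auto
  next
    case False
    then show ?thesis
      using that S by (auto simp: snake_def)
  qed
qed

text \<open>For \<open>n = 9\<close> the only strip is too narrow to contain a zigzag.\<close>

lemma snake_4_0: "snake 4 0 = [(1,0), (2,0), (3,0), (2,1), (1,2), (1,1), (0,2), (0,1), (0,0)]"
  by (simp add: snake_def strips_def strip_def zigzag_def tail_def upt_rec)

lemma snake_props:
  assumes "3 * q + 5 \<le> w \<or> q = 0 \<and> w = 4"
  shows "2 * length (snake w q) + 9 * (q + 1) * (q + 2) = 6 * (q + 1) * w + 6 * (q + 2)"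
    and "distinct (snake w q)"
    and "successively lattice_step (snake w q)"
    and "lattice_step (last (snake w q)) (hd (snake w q))"
    and "u \<in> set (snake w q) \<Longrightarrow> fst u + snd u < w \<and> snd u < 3 * (q + 1)"
proof -
  have "2 * length (snake w q) + 9 * (q + 1) * (q + 2) = 6 * (q + 1) * w + 6 * (q + 2)
    \<and> distinct (snake w q) \<and> successively lattice_step (snake w q)
    \<and> lattice_step (last (snake w q)) (hd (snake w q))
    \<and> (\<forall>u \<in> set (snake w q). fst u + snd u < w \<and> snd u < 3 * (q + 1))"
    using assms
  proof (elim disjE)
    assume "3 * q + 5 \<le> w"
    from snake_props_wide[OF this] show ?thesis
      by blast
  next
    assume "q = 0 \<and> w = 4"
    then show ?thesis
      by (simp add: snake_4_0 lattice_step_def)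
  qed
  then show "2 * length (snake w q) + 9 * (q + 1) * (q + 2) = 6 * (q + 1) * w + 6 * (q + 2)"
    "distinct (snake w q)" "successively lattice_step (snake w q)"
    "lattice_step (last (snake w q)) (hd (snake w q))"
    "u \<in> set (snake w q) \<Longrightarrow> fst u + snd u < w \<and> snd u < 3 * (q + 1)"
    by blast+
qed

section \<open>Dimensions of the snake and conclusion\<close>

text \<open>From \<open>n >= 9 * (q + 1)\<close> follows \<open>w >= 6 * q + 4\<close>, which is
  below \<open>3 * q + 5\<close> only if \<open>q = 0\<close> and \<open>w = 4\<close>, that is, for
  \<open>n = 9\<close>.\<close>

lemma snake_width:
  fixes n :: nat
  assumes "9 \<le> n" "w = n - n div 3 - 2" "q = n div 9 - 1"
  shows "3 * q + 5 \<le> w \<or> q = 0 \<and> w = 4"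
proof (cases "n = 9")
  case False
  define m where "m = n div 3"
  have "3 * m \<le> n" "9 * (q + 1) \<le> n"
    using assms by (auto simp: m_def)
  moreover have "w + m + 2 = n"
    using assms by (auto simp: m_def)
  moreover have "10 \<le> n"
    using False assms(1) by simp
  ultimately have "3 * q + 5 \<le> w"
    by simp
  then show ?thesis ..
qed (use assms in simp)

text \<open>For each residue \<open>r\<close> of \<open>n\<close> modulo 9, six times the length and
  the numerator are the same quadratic polynomial in \<open>q\<close>.\<close>

lemma length_snake_eq_Nprime:
  assumes "9 \<le> n"
  shows "length (snake (n - n div 3 - 2) (n div 9 - 1)) = Nprime n"
proof -
  define q r w where "q = n div 9 - 1" and "r = n mod 9" and "w = n - n div 3 - 2"
  have n: "n = 9 * (q + 1) + r" and "r < 9"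
    using assms by (auto simp: q_def r_def)
  have w: "int w = 6 * int q + 4 + int r - int (r div 3)"
    using n by (simp add: w_def)
  have "2 * length (snake w q) + 9 * (q + 1) * (q + 2) = 6 * (q + 1) * w + 6 * (q + 2)"
    using snake_props(1)[OF snake_width[OF assms w_def q_def]] .
  then have "2 * int (length (snake w q)) + 9 * (int q + 1) * (int q + 2) = 6 * (int q + 1) * int w + 6 * (int q + 2)"
    by (simp add: algebra_simps flip: of_nat_eq_iff[where 'a = int])
  moreover have "r \<in> {0, 1, 2, 3, 4, 5, 6, 7, 8}"
    using \<open>r < 9\<close> by auto
  ultimately have "6 * int (length (snake w q)) = Nprime_numerator n"
    unfolding Nprime_numerator_def r_def[symmetric] w
    by (auto simp: n power2_eq_square algebra_simps)
  then show ?thesis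
    using six_times_Nprime[of n] by (simp add: q_def w_def)
qed

theorem theorem16:
  fixes n :: nat
  assumes "n \<ge> 9"
    and "gcd n (Nprime n div 3) = 1"
  shows "\<exists>G. cyclic_lrm_gray_code n 3 (n * Nprime n) G \<and> single_track n G"
proof -
  define k w q s where "k = n div 3" and "w = n - n div 3 - 2" and "q = n div 9 - 1" and "s = Nprime n div 3"
  have N: "Nprime n = 3 * s"
    using three_dvd_Nprime by (simp add: s_def)
  \<comment> \<open>The \<open>q + 1\<close> strips fit into the \<open>k\<close> rows; at most two
    rows at the top stay empty.\<close>
  have "3 * (q + 1) \<le> k" "w + k + 2 = n"
    using assms(1) by (simp_all add: k_def w_def q_def)
  note P = snake_props[OF snake_width[OF assms(1) w_def q_def]]
  have "gap_cycle n k s (\<lambda>t. w - fst (snake w q ! (t mod (3 * s))) - snd (snake w q ! (t mod (3 * s))))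
      (\<lambda>t. Suc (snd (snake w q ! (t mod (3 * s)))))"
  proof (rule gap_cycle_of_lattice_cycle)
    show "length (snake w q) = 3 * s"
      using length_snake_eq_Nprime[OF assms(1)] N by (simp add: w_def q_def)
    show "coprime n s"
      using assms(2) by (simp add: s_def coprime_iff_gcd_eq_1)
    show "fst u + snd u < w \<and> snd u < k" if "u \<in> set (snake w q)" for u
      using P(5)[OF that] \<open>3 * (q + 1) \<le> k\<close> by simp
  qed (use P \<open>w + k + 2 = n\<close> in auto)
  note code = gap_cycle.cyclic_lrm_gray_code_code[OF this] gap_cycle.single_track_code[OF this]
  show ?thesis
    unfolding N using code by blast
qed

end
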